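(* Let $G$ be a finite abelian group such that the proper power graph $P^\ast(G)$ is connected. Then $\operatorname{diam}(P^\ast(G)) \leq 4$.
   Context: The power graph $P(G)$ of a group $G$ is the simple undirected graph with vertex set $G$ in which two distinct vertices $a,b$ are adjacent if and only if $a\in\langle b\rangle$ or $b\in\langle a\rangle$. The proper power graph $P^\ast(G)$ is the graph obtained from $P(G)$ by deleting the vertex corresponding to the identity element. The diameter of a connected graph is the maximum over all pairs of vertices of the length of a shortest path between them. *)

theory Defs
  imports "HOL-Algebra.Generated_Groups" "Graph_Theory.Graph_Theory"
begin

text \<open>Undirected graphs are symmetric digraphs, as in locale \<open>graph\<close> of \<open>Graph_Theory\<close>:
  the edge joining \<open>a\<close> and \<open>b\<close> is the pair of arcs \<open>(a, b)\<close>, \<open>(b, a)\<close>.\<close>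

definition power_graph :: "('a, 'b) monoid_scheme \<Rightarrow> ('a, 'a \<times> 'a) pre_digraph" where
  "power_graph G =
    \<lparr> verts = carrier G,
      arcs = {(a, b). a \<in> carrier G \<and> b \<in> carrier G \<and> a \<noteq> b \<and>
                      (a \<in> generate G {b} \<or> b \<in> generate G {a})},
      tail = fst, head = snd \<rparr>"

definition proper_power_graph :: "('a, 'b) monoid_scheme \<Rightarrow> ('a, 'a \<times> 'a) pre_digraph" where
  "proper_power_graph G = pre_digraph.del_vert (power_graph G) \<one>\<^bsub>G\<^esub>"

text \<open>With unit weights the cost of a walk is its number of arcs, so \<open>\<mu>\<close> is the length of a
  shortest path (and \<open>\<infinity>\<close> if there is none). For a finite connected graph the supremum is a
  maximum; connectedness in \<open>Graph_Theory\<close> includes having at least one vertex.\<close>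

definition graph_diameter :: "('a, 'b) pre_digraph \<Rightarrow> ereal" where
  "graph_diameter H = (SUP (u, v) \<in> verts H \<times> verts H. wf_digraph.\<mu> H (\<lambda>_. 1) u v)"

lemma graph_power_graph:
  assumes "finite (carrier G)"
  shows "graph (power_graph G)"
proof
  show "finite (arcs (power_graph G))"
    by (rule finite_subset[of _ "carrier G \<times> carrier G"]) (auto simp: power_graph_def assms)
  show "symmetric (power_graph G)"
    by (auto simp: symmetric_conv power_graph_def)
qed (auto simp: power_graph_def arc_to_ends_def assms)

text \<open>In particular \<open>wf_digraph.\<mu>\<close> is applied to a well-formed graph.\<close>

lemma graph_proper_power_graph:
  assumes "finite (carrier G)"
  shows "graph (proper_power_graph G)"
proof -
  interpret graph "power_graph G"
    by (rule graph_power_graph[OF assms])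
  interpret D: fin_digraph "proper_power_graph G"
    unfolding proper_power_graph_def by (rule fin_digraph_del_vert)
  show ?thesis
  proof
    show "symmetric (proper_power_graph G)"
      using sym_arcs
      by (fastforce simp: symmetric_conv proper_power_graph_def del_vert_simps)
  qed (use no_loops no_multi_arcs in
        \<open>auto simp: proper_power_graph_def del_vert_simps ends_del_vert\<close>)
qed

end

theory Submission
  imports Defs "HOL-Algebra.Multiplicative_Group" "HOL-Number_Theory.Cong"
begin

text \<open>In an abelian group \<open>x\<close> and \<open>y\<close> are powers of \<open>xy\<close> whenever their orders are coprime.
  Let \<open>a\<close>, \<open>b\<close> be nontrivial. If distinct primes \<open>q\<close>, \<open>r\<close> divide the orders of \<open>a\<close>, \<open>b\<close>, take
  powers \<open>a'\<close>, \<open>b'\<close> of these orders; then \<open>a, a', a'b', b', b\<close> is a walk. Otherwise both orders are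
  powers of one prime \<open>p\<close>. If some nontrivial \<open>c\<close> has order prime to \<open>p\<close>, then \<open>a, ac, c, bc, b\<close> is a
  walk. Otherwise \<open>G\<close> is a \<open>p\<close>-group, where having nontrivially intersecting cyclic subgroups is a
  transitive relation; hence, by connectedness, it relates \<open>a\<close> to \<open>b\<close>, and these have a common
  nontrivial power.\<close>

section \<open>Distance bounds in the proper power graph from explicit walks\<close>

text \<open>Admitting \<open>v = w\<close> spares later case splits on whether consecutive vertices
  of a walk coincide.\<close>

lemma (in fin_digraph) mu_unit_cost_step:
  assumes "\<mu> (\<lambda>_. 1) u v \<le> r" and "v = w \<or> v \<rightarrow>\<^bsub>G\<^esub> w"
  shows "\<mu> (\<lambda>_. 1) u w \<le> r + 1"
  using assms(2)
proof
  assume "v = w"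
  with assms(1) have "\<mu> (\<lambda>_. 1) u w \<le> r + 0"
    by simp
  also have "\<dots> \<le> r + 1"
    by (rule add_left_mono) simp
  finally show ?thesis .
next
  assume "v \<rightarrow>\<^bsub>G\<^esub> w"
  then obtain e where "arc e (v, w)"
    by (auto simp: arcs_ends_def arc_def arc_to_ends_def)
  then have "\<mu> (\<lambda>_. 1) u w \<le> \<mu> (\<lambda>_. 1) u v + ereal 1"
    by (intro pos_cost_mu_triangle) (auto simp: arc_def arc_to_ends_def)
  also have "\<dots> \<le> r + 1"
    using assms(1) by (simp add: add_right_mono one_ereal_def)
  finally show ?thesis .
qed

lemma verts_proper_power_graph: "verts (proper_power_graph G) = carrier G - {\<one>\<^bsub>G\<^esub>}"
  by (simp add: proper_power_graph_def pre_digraph.del_vert_simps power_graph_def)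

lemma adj_proper_power_graph:
  "x \<rightarrow>\<^bsub>proper_power_graph G\<^esub> y \<longleftrightarrow>
    x \<in> carrier G - {\<one>\<^bsub>G\<^esub>} \<and> y \<in> carrier G - {\<one>\<^bsub>G\<^esub>} \<and> x \<noteq> y \<and>
    (x \<in> generate G {y} \<or> y \<in> generate G {x})"
  by (auto simp: proper_power_graph_def power_graph_def pre_digraph.del_vert_simps arcs_ends_def
      arc_to_ends_def image_iff)

text \<open>Entries may repeat, so a shorter walk can be padded to five entries.\<close>

lemma mu_proper_power_graph_le_4:
  fixes G (structure)
  assumes "finite (carrier G)"
    and "set [a, b, c, d, e] \<subseteq> carrier G - {\<one>}"
    and "successively (\<lambda>x y. x \<in> generate G {y} \<or> y \<in> generate G {x}) [a, b, c, d, e]"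
  shows "wf_digraph.\<mu> (proper_power_graph G) (\<lambda>_. 1) a e \<le> 4"
proof -
  interpret graph "proper_power_graph G"
    by (rule graph_proper_power_graph[OF assms(1)])
  have step: "\<mu> (\<lambda>_. 1) a y \<le> r + 1"
    if "\<mu> (\<lambda>_. 1) a x \<le> r" "x \<in> carrier G - {\<one>}" "y \<in> carrier G - {\<one>}"
      "x \<in> generate G {y} \<or> y \<in> generate G {x}" for x y r
    using that by (intro mu_unit_cost_step[of a x r y]) (auto simp: adj_proper_power_graph)
  have "awalk a [] a"
    using assms(2) by (simp add: awalk_Nil_iff verts_proper_power_graph)
  then have "\<mu> (\<lambda>_. 1) a a \<le> 0"
    using min_cost_le_walk_cost[of a "[]" a "\<lambda>_. 1"] by (simp add: zero_ereal_def)
  then have "\<mu> (\<lambda>_. 1) a e \<le> 0 + 1 + 1 + 1 + 1"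
    using assms(2,3) step[of a 0 b] step[of b "0 + 1" c] step[of c "0 + 1 + 1" d]
      step[of d "0 + 1 + 1 + 1" e] by simp
  then show ?thesis
    by simp
qed

section \<open>Cyclic subgroups and element orders\<close>

context group begin

lemma pow_in_generate:
  "x \<in> carrier G \<Longrightarrow> x [^] (n::nat) \<in> generate G {x}"
  using generate_pow[of x] int_pow_int[of G x n, symmetric] by blast

lemma pow_cong_ord:
  assumes "x \<in> carrier G" "[m = n] (mod ord x)"
  shows "x [^] m = x [^] (n::nat)"
proof -
  have "[int n = int m] (mod int (ord x))"
    using assms(2) by (simp add: cong_int_iff cong_sym)
  then show ?thesis
    using int_pow_eq[OF assms(1), of "int m" "int n"]
    by (simp add: cong_iff_dvd_diff int_pow_int)
qed

lemma in_generate_trans: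
  assumes "x \<in> generate G {y}" "y \<in> generate G {z}" "z \<in> carrier G"
  shows "x \<in> generate G {z}"
  using assms generate_subgroup_incl[OF _ generate_is_subgroup[of "{z}"], of "{y}"] by blast

text \<open>The subgroups of a cyclic p-group form a chain, so each nontrivial one contains the
  unique subgroup of order p, which \<open>x [^] (p ^ (k - 1))\<close> generates.\<close>

lemma generate_prime_power_ord_contains:
  assumes x: "x \<in> carrier G" and "prime p" and ord: "ord x = p ^ k"
    and z: "z \<in> generate G {x}" "z \<noteq> \<one>"
  shows "x [^] (p ^ (k - 1)) \<in> generate G {z}"
proof -
  have "ord x \<noteq> 0"
    using \<open>prime p\<close> ord by auto
  then obtain i :: nat where i: "z = x [^] i"
    using z(1) generate_pow_nat[OF x] by blast
  then have "\<not> p ^ k dvd i"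
    using z(2) pow_eq_id[OF x, of i] ord by auto
  \<comment> \<open>This gcd is a power of p other than \<open>p ^ k\<close>, so it divides
    \<open>p ^ (k - 1)\<close>; that is the solvability criterion for the congruence in t
    below.\<close>
  obtain j where j: "gcd i (p ^ k) = p ^ j" "j \<le> k"
    using \<open>prime p\<close> divides_primepow_nat[of p "gcd i (p ^ k)" k] by auto
  with \<open>\<not> p ^ k dvd i\<close> have "j \<noteq> k"
    by (metis gcd_dvd1)
  with j have "gcd i (p ^ k) dvd p ^ (k - 1)"
    by (simp add: le_imp_power_dvd)
  then obtain t where "[i * t = p ^ (k - 1)] (mod ord x)"
    using cong_solve_dvd_nat ord by metis
  then have "x [^] (p ^ (k - 1)) = z [^] t"
    using x i by (metis pow_cong_ord nat_pow_pow)
  then show ?thesis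
    using pow_in_generate x i by simp
qed

text \<open>The cyclic subgroups generated by v and w are nontrivial inside that of y, so both
  contain its subgroup of order p.\<close>

lemma prime_power_ord_generate_inter_trans:
  assumes "y \<in> carrier G" "prime p" "ord y = p ^ k"
    and "v \<in> generate G {x} \<inter> generate G {y}" "v \<noteq> \<one>"
    and "w \<in> generate G {y} \<inter> generate G {z}" "w \<noteq> \<one>"
    and "x \<in> carrier G" "z \<in> carrier G"
  shows "\<exists>u. u \<in> generate G {x} \<inter> generate G {z} \<and> u \<noteq> \<one>"
proof (intro exI conjI)
  let ?u = "y [^] (p ^ (k - 1))"
  show "?u \<in> generate G {x} \<inter> generate G {z}"
    using assms generate_prime_power_ord_contains[of y p k] in_generate_trans by blast
  have "y \<noteq> \<one>"
    using assms generate_one by auto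
  \<comment> \<open>For \<open>k = 0\<close> the truncated \<open>k - 1\<close> would equal k and
    \<open>?u\<close> would be trivial.\<close>
  then have "k \<noteq> 0"
    using assms ord_eq_1[of y] by auto
  with \<open>prime p\<close> have "\<not> p ^ k dvd p ^ (k - 1)"
    by (simp add: power_dvd_imp_le prime_nat_iff dvd_power_iff_le prime_ge_2_nat)
  then show "?u \<noteq> \<one>"
    using assms pow_eq_id by simp
qed

lemma exists_power_of_prime_ord:
  assumes "finite (carrier G)" "x \<in> carrier G" "prime p" "p dvd ord x"
  obtains y where "y \<in> generate G {x}" "ord y = p"
proof -
  obtain m where m: "ord x = p * m"
    using assms(4) by (elim dvdE)
  have "ord x > 0"
    using ord_ge_1[OF assms(1,2)] by simp
  then have "ord (x [^] m) = p"
    using m ord_pow[OF assms(2), of m] by simp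
  then show ?thesis
    using that pow_in_generate[OF assms(2)] by blast
qed

end

text \<open>An exponent that is 0 modulo \<open>ord y\<close> and 1 modulo \<open>ord x\<close>
  kills y and fixes x, hence sends the product to x.\<close>

lemma (in comm_group) in_generate_mult_coprime_ord:
  assumes x: "x \<in> carrier G" and y: "y \<in> carrier G" and "coprime (ord x) (ord y)"
  shows "x \<in> generate G {x \<otimes> y}"
proof -
  obtain t where "[ord y * t = Suc 0] (mod ord x)"
    using assms(3) cong_solve_coprime_nat[of "ord y" "ord x"] by (auto simp: coprime_commute)
  then have "x [^] (ord y * t) = x"
    using pow_cong_ord[OF x, of "ord y * t" "Suc 0"] x by simp
  moreover have "y [^] (ord y * t) = \<one>"
    using y by (simp add: pow_eq_id)
  ultimately have "(x \<otimes> y) [^] (ord y * t) = x"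
    using x y by (simp add: pow_mult_distrib m_comm)
  then show ?thesis
    using pow_in_generate[of "x \<otimes> y" "ord y * t"] x y by simp
qed

section \<open>Distance of two vertices according to the primes dividing their orders\<close>

theorem theorem3p7:
  fixes G :: "('a, 'b) monoid_scheme"
  assumes "comm_group G"
    and "finite (carrier G)"
    and "connected (proper_power_graph G)"
  shows "graph_diameter (proper_power_graph G) \<le> 4"
proof -
  interpret comm_group G by fact
  interpret P: graph "proper_power_graph G"
    by (rule graph_proper_power_graph) fact
  \<comment> \<open>\<open>connected\<close> speaks of the symmetric closure; the arcs are already
    symmetric, so reachability holds in the graph itself.\<close>
  have reach: "u \<rightarrow>\<^sup>*\<^bsub>proper_power_graph G\<^esub> v"
    if "u \<in> carrier G - {\<one>\<^bsub>G\<^esub>}" "v \<in> carrier G - {\<one>\<^bsub>G\<^esub>}" for u v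
    using P.symmetric_connected_imp_strongly_connected[OF P.sym_arcs assms(3)] that
    by (auto simp: strongly_connected_def verts_proper_power_graph)
  have gen_carrier: "x \<in> carrier G" if "x \<in> generate G {y}" "y \<in> carrier G" for x y
    using that generate_in_carrier by blast
  have gen_one: "y \<noteq> \<one>\<^bsub>G\<^esub>" if "x \<in> generate G {y}" "x \<noteq> \<one>\<^bsub>G\<^esub>" for x y
    using that generate_one by auto
  have "P.\<mu> (\<lambda>_. 1) a b \<le> 4" if ab: "a \<in> carrier G - {\<one>\<^bsub>G\<^esub>}" "b \<in> carrier G - {\<one>\<^bsub>G\<^esub>}" for a b
  proof -
    obtain p where p: "prime p" "p dvd ord a"
      using ab ord_eq_1[of a] prime_factor_nat by blast
    consider (distinct) q r where "prime q" "q dvd ord a" "prime r" "r dvd ord b" "q \<noteq> r"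
      | (coprime) c where "c \<in> carrier G - {\<one>\<^bsub>G\<^esub>}" "coprime (ord a) (ord c)" "coprime (ord b) (ord c)"
      | (primary) "\<And>x q. x \<in> carrier G \<Longrightarrow> prime q \<Longrightarrow> q dvd ord x \<Longrightarrow> q = p"
    proof (cases "\<forall>q. prime q \<longrightarrow> q dvd ord a \<or> q dvd ord b \<longrightarrow> q = p")
      case False
      \<comment> \<open>A prime other than p dividing \<open>ord b\<close> is paired with p. If it
        divides \<open>ord a\<close> instead, then it or p differs from r and is paired with
        r.\<close>
      moreover obtain r where "prime r" "r dvd ord b"
        using ab ord_eq_1[of b] prime_factor_nat by blast
      ultimately show ?thesis
        using p that(1) by metis
    next
      case only_p: True
      show ?thesis
      proof (cases "\<forall>x \<in> carrier G. \<forall>q. prime q \<longrightarrow> q dvd ord x \<longrightarrow> q = p")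
        case True
        then show ?thesis
          using that(3) by blast
      next
        case False
        then obtain x q where x: "x \<in> carrier G" "prime q" "q dvd ord x" "q \<noteq> p"
          by blast
        \<comment> \<open>The order of x may still be divisible by p; passing to a power of order q
          removes that factor.\<close>
        then obtain c where c: "c \<in> generate G {x}" "ord c = q"
          using exists_power_of_prime_ord assms(2) by blast
        have "c \<noteq> \<one>\<^bsub>G\<^esub>"
          using c x by auto
        moreover have "coprime (ord a) q" "coprime (ord b) q"
          using only_p x prime_imp_coprime[of q] by (metis coprime_commute)+
        ultimately show ?thesis
          using that(2) c x gen_carrier by auto
      qed
    qed
    then show ?thesis
    proof cases
      case distinct
      obtain a' where a': "a' \<in> generate G {a}" "ord a' = q"
        using exists_power_of_prime_ord assms(2) ab distinct by blast
      obtain b' where b': "b' \<in> generate G {b}" "ord b' = r"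
        using exists_power_of_prime_ord assms(2) ab distinct by blast
      have car: "a' \<in> carrier G" "b' \<in> carrier G"
        using a' b' ab gen_carrier by auto
      have ne: "a' \<noteq> \<one>\<^bsub>G\<^esub>" "b' \<noteq> \<one>\<^bsub>G\<^esub>"
        using a' b' distinct by auto
      have cop: "coprime (ord a') (ord b')"
        using a' b' distinct by (simp add: primes_coprime)
      have gen: "a' \<in> generate G {a' \<otimes>\<^bsub>G\<^esub> b'}" "b' \<in> generate G {a' \<otimes>\<^bsub>G\<^esub> b'}"
        using in_generate_mult_coprime_ord[of a' b'] in_generate_mult_coprime_ord[of b' a'] cop car
        by (simp_all add: m_comm coprime_commute)
      have "a' \<otimes>\<^bsub>G\<^esub> b' \<noteq> \<one>\<^bsub>G\<^esub>"
        using gen_one gen(1) ne(1) by blast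
      then show ?thesis
        by (intro mu_proper_power_graph_le_4[of G a a' "a' \<otimes>\<^bsub>G\<^esub> b'" b' b])
          (use assms(2) ab a'(1) b'(1) car ne gen in simp_all)
    next
      case (coprime c)
      have gen: "a \<in> generate G {a \<otimes>\<^bsub>G\<^esub> c}" "c \<in> generate G {a \<otimes>\<^bsub>G\<^esub> c}"
        "b \<in> generate G {b \<otimes>\<^bsub>G\<^esub> c}" "c \<in> generate G {b \<otimes>\<^bsub>G\<^esub> c}"
        using in_generate_mult_coprime_ord[of a c] in_generate_mult_coprime_ord[of c a]
          in_generate_mult_coprime_ord[of b c] in_generate_mult_coprime_ord[of c b] ab coprime
        by (simp_all add: m_comm coprime_commute)
      have "a \<otimes>\<^bsub>G\<^esub> c \<noteq> \<one>\<^bsub>G\<^esub>" "b \<otimes>\<^bsub>G\<^esub> c \<noteq> \<one>\<^bsub>G\<^esub>"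
        using gen_one gen(1,3) ab by blast+
      then show ?thesis
        by (intro mu_proper_power_graph_le_4[of G a "a \<otimes>\<^bsub>G\<^esub> c" c "b \<otimes>\<^bsub>G\<^esub> c" b])
          (use assms(2) ab coprime(1) gen in simp_all)
    next
      case primary
      have prime_power: "\<exists>k. ord x = p ^ k" if "x \<in> carrier G" for x
      proof -
        have "ord x \<noteq> 0"
          using ord_ge_1[OF assms(2) that] by simp
        moreover have "\<not> (\<exists>q \<in> prime_factors (ord x). q \<noteq> p)"
          using primary[OF that] by (meson in_prime_factors_iff)
        ultimately show ?thesis
          using Ex_other_prime_factor[of "ord x" p] p(1) by auto
      qed
      \<comment> \<open>Connectedness enters here: sharing a nontrivial element with the cyclic
        subgroup of a is carried along a walk from a to b.\<close>
      have "\<exists>z. z \<in> generate G {a} \<inter> generate G {b} \<and> z \<noteq> \<one>\<^bsub>G\<^esub>"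
        using reach[OF ab]
      proof (induction rule: P.reachable_induct)
        case base
        then show ?case
          using ab generate.incl[of a "{a}"] by blast
      next
        case (step x y)
        then have xy: "x \<in> carrier G" "y \<in> carrier G" "x \<noteq> \<one>\<^bsub>G\<^esub>" "y \<noteq> \<one>\<^bsub>G\<^esub>"
          "x \<in> generate G {y} \<or> y \<in> generate G {x}"
          by (auto simp: adj_proper_power_graph)
        \<comment> \<open>Whichever of x and y is a power of the other serves as w.\<close>
        then obtain w where w: "w \<in> generate G {x} \<inter> generate G {y}" "w \<noteq> \<one>\<^bsub>G\<^esub>"
          using generate.incl[of x "{x}"] generate.incl[of y "{y}"] by blast
        obtain v where v: "v \<in> generate G {a} \<inter> generate G {x}" "v \<noteq> \<one>\<^bsub>G\<^esub>"
          using step.IH by blast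
        obtain k where "ord x = p ^ k"
          using prime_power xy(1) by blast
        then show ?case
          using prime_power_ord_generate_inter_trans[OF xy(1) p(1) _ v w] xy(2) ab by blast
      qed
      then obtain z where "z \<in> generate G {a} \<inter> generate G {b}" "z \<noteq> \<one>\<^bsub>G\<^esub>"
        by blast
      moreover from this have "z \<in> carrier G"
        using ab gen_carrier by blast
      moreover have "a \<in> generate G {a}" "b \<in> generate G {b}"
        by (simp_all add: generate.incl)
      \<comment> \<open>The walk a, z, b is padded by repeating its ends.\<close>
      ultimately show ?thesis
        by (intro mu_proper_power_graph_le_4[of G a a z b b]) (use assms(2) ab in simp_all)
    qed
  qed
  then show ?thesis
    by (auto simp: graph_diameter_def verts_proper_power_graph intro!: SUP_least)
qed

end
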